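(* Let $k,\ell,m\ge 1$ be integers, let $M=\{f_1,\dots,f_m\}\subset\mathbf{R}^k$, and let $$\Lambda(a_1,\dots,a_m)=\int_{\mathbf{R}^{k\ell}}\prod_{j=1}^m a_j(f_j\cdot x)\,dx,\qquad a_j\in L^1(\mathbf{R}^\ell)\cap L^\infty(\mathbf{R}^\ell).$$ Let $\theta=(\theta_1,\dots,\theta_m)\in[0,1]^m$ and suppose there is a finite constant $C_\theta$ such that $$|\Lambda(a_1,\dots,a_m)|\le C_\theta\prod_{j=1}^m\|a_j\|_{\theta_j}\qquad\text{for all }a_1,\dots,a_m\in L^1(\mathbf{R}^\ell)\cap L^\infty(\mathbf{R}^\ell).$$ Then $\theta\in\Omega_M$, where $\Omega_M$ is the (basis) matroid polytope of $M$.
   Context: For $x=(x_1,\dots,x_k)\in\mathbf{R}^{k\ell}$ with each $x_i\in\mathbf{R}^\ell$ and $f_j=(f_{j1},\dots,f_{jk})\in\mathbf{R}^k$, set $f_j\cdot x=\sum_{i=1}^k f_{ji}x_i\in\mathbf{R}^\ell$. The notation $\|f\|_{1/p}$ denotes the $L^p$ norm of $f$, with $1/\infty=0$; so $\|a\|_{\theta}$ is the norm in $L^{1/\theta}(\mathbf{R}^\ell)$, and $\|a\|_0$ is the $L^\infty$ norm. The assumed estimate is understood to include that the integral defining $\Lambda$ converges absolutely for all such $a_j$. For $S\subset M$, $\chi_S\in\{0,1\}^m$ is the vector whose $i$th component is $1$ if $f_i\in S$ and $0$ otherwise. The matroid polytope $\Omega_M$ is the convex hull of $\{\chi_B: B\subset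 M \text{ is a basis for }\mathbf{R}^k\}$. *)

theory Defs
  imports "HOL-Analysis.Analysis" "HOL-Probability.Essential_Supremum"
begin

definition L1_Linf :: "('a::euclidean_space \<Rightarrow> real) set" where
  "L1_Linf = {a. integrable lborel a \<and> esssup lborel (\<lambda>x. ereal \<bar>a x\<bar>) < \<infinity>}"

(* The norm is indexed by the reciprocal exponent: Lnorm t is the norm of L^(1/t), and Lnorm 0
   is the L^infinity norm. It is only meaningful for 0 \<le> t \<le> 1 and a \<in> L1_Linf, where
   the norm is finite and hence can be a real number. *)
definition Lnorm :: "real \<Rightarrow> ('a::euclidean_space \<Rightarrow> real) \<Rightarrow> real" where
  "Lnorm t a =
     (if t = 0 then real_of_ereal (esssup lborel (\<lambda>x. ereal \<bar>a x\<bar>))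
      else (\<integral>x. \<bar>a x\<bar> powr (1 / t) \<partial>lborel) powr t)"

definition block_dot :: "real ^ 'k \<Rightarrow> (real ^ 'l) ^ 'k \<Rightarrow> real ^ 'l" where
  "block_dot v x = (\<Sum>i\<in>UNIV. (v $ i) *\<^sub>R (x $ i))"

definition Lambda_integrand ::
    "('m::finite \<Rightarrow> real ^ 'k) \<Rightarrow> ('m \<Rightarrow> real ^ 'l \<Rightarrow> real) \<Rightarrow> (real ^ 'l) ^ 'k \<Rightarrow> real" where
  "Lambda_integrand f a x = (\<Prod>j\<in>UNIV. a j (block_dot (f j) x))"

definition Lambda :: "('m::finite \<Rightarrow> real ^ 'k) \<Rightarrow> ('m \<Rightarrow> real ^ 'l \<Rightarrow> real) \<Rightarrow> real" where
  "Lambda f a = (\<integral>x. Lambda_integrand f a x \<partial>lborel)"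

(* The ground set of the matroid is the index type, so that repeated vectors are parallel elements.
   For pairwise distinct vectors this is the description by subsets of the set
   of vectors, see matroid_polytope_distinct. *)
definition family_basis :: "('m \<Rightarrow> real ^ 'k) \<Rightarrow> 'm set \<Rightarrow> bool" where
  "family_basis f B \<longleftrightarrow> inj_on f B \<and> independent (f ` B) \<and> span (f ` B) = UNIV"

definition chi_vec :: "'m set \<Rightarrow> real ^ 'm" where
  "chi_vec S = (\<chi> i. if i \<in> S then 1 else 0)"

definition matroid_polytope :: "('m \<Rightarrow> real ^ 'k) \<Rightarrow> (real ^ 'm) set" where
  "matroid_polytope f = convex hull {chi_vec B | B. family_basis f B}"

lemma matroid_polytope_distinct:
  fixes f :: "'m::finite \<Rightarrow> real ^ 'k"
  assumes "inj f"
  shows "matroid_polytope f = convex hull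
    {(\<chi> i. if f i \<in> B then 1 else 0) | B. B \<subseteq> range f \<and> independent B \<and> span B = UNIV}"
proof -
  have "{chi_vec B | B. family_basis f B} =
    {(\<chi> i. if f i \<in> B then 1 else 0) | B. B \<subseteq> range f \<and> independent B \<and> span B = UNIV}"
    (is "?L = ?R")
  proof (intro equalityI subsetI)
    fix v assume "v \<in> ?L"
    then obtain B where B: "v = chi_vec B" "family_basis f B" by blast
    have "v = (\<chi> i. if f i \<in> f ` B then 1 else 0)"
      using assms by (simp add: B(1) chi_vec_def inj_image_mem_iff)
    moreover have "f ` B \<subseteq> range f \<and> independent (f ` B) \<and> span (f ` B) = UNIV"
      using B(2) by (auto simp: family_basis_def)
    ultimately show "v \<in> ?R" by blast
  next
    fix v assume "v \<in> ?R"
    then obtain B where B: "v = (\<chi> i. if f i \<in> B then 1 else 0)" "B \<subseteq> range f"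
      "independent B" "span B = UNIV" by blast
    have "f ` (f -` B) = B" using B(2) by auto
    then have "family_basis f (f -` B)"
      using B(3,4) assms by (auto simp: family_basis_def intro: inj_on_subset)
    moreover have "v = chi_vec (f -` B)" by (simp add: B(1) chi_vec_def)
    ultimately show "v \<in> ?L" by blast
  qed
  then show ?thesis by (simp add: matroid_polytope_def)
qed

end

theory Submission
  imports Defs
begin

text \<open>
  Separate and test. If \<open>\<theta>\<close> lay outside the polytope, a linear functional \<open>w\<close> would separate it
  from all vertices: \<open>w \<bullet> \<theta> < w(B)\<close> for every basis \<open>B\<close>, where \<open>w(B)\<close> is the sum of \<open>w\<close> over \<open>B\<close>.
  The functional itself prescribes the functions that refute the estimate. Let \<open>a\<^sub>j\<close> be the
  indicator of the cube of half-width \<open>exp (t * w\<^sub>j)\<close> in \<open>\<real>\<^sup>l\<close>. Up to a constant factor, the right-hand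
  side of the estimate is \<open>exp (l * t * (w \<bullet> \<theta>))\<close>, and the left-hand side is the volume of
  \<open>E\<^sub>t = {x. \<forall>j. f\<^sub>j \<cdot> x \<in> cube (exp (t * w\<^sub>j))}\<close>.

  Let \<open>B\<close> be a basis of least weight. By the exchange property, the expansion of each \<open>f\<^sub>j\<close> in the
  basis involves only those \<open>f\<^sub>i\<close> with \<open>w\<^sub>i \<le> w\<^sub>j\<close> (\<open>min_weight_basis_expansion\<close>). For \<open>t \<ge> 0\<close> the
  constraints with \<open>j \<notin> B\<close> therefore follow, up to a constant, from those with \<open>i \<in> B\<close>, and the
  latter alone cut out a set that a fixed linear bijection carries onto a box. So the volume of \<open>E\<^sub>t\<close>
  is at least a constant times \<open>exp (l * t * w(B))\<close> (\<open>slab_body_volume_lower_bound\<close>). As \<open>t\<close> tends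
  to infinity, the estimate forces \<open>w(B) \<le> w \<bullet> \<theta>\<close>, a contradiction.

  Bases do exist: otherwise some nonzero vector is orthogonal to all \<open>f\<^sub>j\<close>, so that \<open>E\<^sub>0\<close> contains an
  open set and is invariant under translations along a line, hence has infinite volume
  (\<open>slab_body_infinite_volume\<close>), while absolute convergence makes its volume finite.
\<close>

section \<open>Linear change of variables for Lebesgue measure\<close>

lemma nn_integral_lborel_translate:
  fixes g :: "'a::euclidean_space \<Rightarrow> ennreal"
  assumes [measurable]: "g \<in> borel_measurable borel"
  shows "(\<integral>\<^sup>+x. g x \<partial>lborel) = (\<integral>\<^sup>+x. g (c + x) \<partial>lborel)"
  by (subst lborel_distr_plus[of c, symmetric], subst nn_integral_distr) simp_all

text \<open>
  The uniqueness argument for Haar measure. Both sides are the value of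
  \<open>\<integral>\<integral> 1\<^bsub>U\<^esub>(y) 1\<^bsub>Q\<^esub>(y + S x) dx dy\<close>: translating \<open>x\<close> removes \<open>y\<close> from the second factor,
  and translating \<open>y\<close> moves \<open>S x\<close> to the first factor, after which translating \<open>x\<close> removes \<open>y\<close> there.
\<close>
lemma emeasure_lborel_linear_vimage_symmetric:
  fixes S :: "'a::euclidean_space \<Rightarrow> 'b::euclidean_space"
  assumes "linear S" "surj S" and [measurable]: "U \<in> sets borel" "Q \<in> sets borel"
  shows "emeasure lborel U * emeasure lborel (S -` Q) =
         emeasure lborel Q * emeasure lborel {x. - S x \<in> U}"
proof -
  obtain T where T: "S (T y) = y" for y
    using \<open>surj S\<close> by (metis surj_f_inv_f)
  have add: "S (T y + x) = y + S x" for x y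
    using \<open>linear S\<close> by (simp add: linear_add T)
  have [measurable]: "S \<in> borel_measurable borel"
    using \<open>linear S\<close> by (intro borel_measurable_continuous_onI linear_continuous_on
        linear_conv_bounded_linear[THEN iffD1])
  have "emeasure lborel U * emeasure lborel (S -` Q) =
      (\<integral>\<^sup>+y. indicator U y * (\<integral>\<^sup>+x. indicator Q (S x) \<partial>lborel) \<partial>lborel)"
  proof -
    have "(\<integral>\<^sup>+x. indicator Q (S x) \<partial>lborel) = (\<integral>\<^sup>+x. indicator (S -` Q) x \<partial>lborel)"
      by (intro nn_integral_cong) (auto simp: indicator_def)
    also have "\<dots> = emeasure lborel (S -` Q)"
      using measurable_sets[of S borel borel Q] by (intro nn_integral_indicator) auto
    finally show ?thesis
      by (simp add: nn_integral_multc)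
  qed
  also have "\<dots> = (\<integral>\<^sup>+y. \<integral>\<^sup>+x. indicator U y * indicator Q (y + S x) \<partial>lborel \<partial>lborel)"
  proof (rule nn_integral_cong)
    fix y
    show "indicator U y * (\<integral>\<^sup>+x. indicator Q (S x) \<partial>lborel) =
        (\<integral>\<^sup>+x. indicator U y * indicator Q (y + S x) \<partial>lborel)"
      by (subst nn_integral_lborel_translate[of _ "T y"]) (simp_all add: add nn_integral_cmult)
  qed
  also have "\<dots> = (\<integral>\<^sup>+x. \<integral>\<^sup>+y. indicator U y * indicator Q (y + S x) \<partial>lborel \<partial>lborel)"
    by (rule lborel_pair.Fubini') measurable
  also have "\<dots> = (\<integral>\<^sup>+x. \<integral>\<^sup>+y. indicator U (y - S x) * indicator Q y \<partial>lborel \<partial>lborel)"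
  proof (rule nn_integral_cong)
    fix x
    show "(\<integral>\<^sup>+y. indicator U y * indicator Q (y + S x) \<partial>lborel) =
        (\<integral>\<^sup>+y. indicator U (y - S x) * indicator Q y \<partial>lborel)"
      by (subst nn_integral_lborel_translate[of _ "- S x"]) simp_all
  qed
  also have "\<dots> = (\<integral>\<^sup>+y. \<integral>\<^sup>+x. indicator U (y - S x) * indicator Q y \<partial>lborel \<partial>lborel)"
    by (rule lborel_pair.Fubini') measurable
  also have "\<dots> = (\<integral>\<^sup>+y. (\<integral>\<^sup>+x. indicator U (- S x) \<partial>lborel) * indicator Q y \<partial>lborel)"
  proof (rule nn_integral_cong)
    fix y
    show "(\<integral>\<^sup>+x. indicator U (y - S x) * indicator Q y \<partial>lborel) =
        (\<integral>\<^sup>+x. indicator U (- S x) \<partial>lborel) * indicator Q y"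
      by (subst nn_integral_lborel_translate[of _ "T y"]) (simp_all add: add nn_integral_multc)
  qed
  also have "\<dots> = (\<integral>\<^sup>+x. indicator U (- S x) \<partial>lborel) * emeasure lborel Q"
    by (simp add: nn_integral_cmult)
  also have "(\<integral>\<^sup>+x. indicator U (- S x) \<partial>lborel) =
      (\<integral>\<^sup>+x. indicator {x. - S x \<in> U} x \<partial>lborel)"
    by (intro nn_integral_cong) (auto simp: indicator_def)
  also have "\<dots> = emeasure lborel {x. - S x \<in> U}"
    by (intro nn_integral_indicator) measurable
  finally show ?thesis
    by (simp add: mult.commute)
qed

text \<open>
  The previous identity with the unit ball as \<open>U\<close> gives the constant as a ratio of two volumes. This
  suffices here without identifying it as a determinant, and it covers arbitrary Euclidean spaces,
  such as spaces of block vectors, where no matrix is at hand.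
\<close>
lemma emeasure_lborel_linear_vimage:
  fixes S :: "'a::euclidean_space \<Rightarrow> 'b::euclidean_space"
  assumes "linear S" "bij S"
  obtains c :: real where "c > 0"
    "\<And>Q. Q \<in> sets borel \<Longrightarrow> emeasure lborel (S -` Q) = ennreal c * emeasure lborel Q"
proof -
  define U where "U = ball (0::'b) 1"
  define V where "V = measure lborel U"
  define N where "N = measure lborel (S -` U)"
  have V: "emeasure lborel U = ennreal V" "V > 0"
    using content_ball_pos[of 1 "0::'b"]
    by (auto simp: V_def U_def less_imp_neq[OF emeasure_lborel_ball_finite, simplified]
        intro!: emeasure_eq_ennreal_measure)
  obtain T where "linear T" and TS: "T \<circ> S = id"
    using linear_injective_left_inverse[OF \<open>linear S\<close> bij_is_inj[OF \<open>bij S\<close>]] by blast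
  then have "bounded (T ` U)"
    by (simp add: U_def bounded_linear_image linear_conv_bounded_linear)
  moreover have "S -` U \<subseteq> T ` U"
  proof
    fix x assume "x \<in> S -` U"
    moreover have "x = T (S x)"
      using TS by (simp add: fun_eq_iff)
    ultimately show "x \<in> T ` U" by blast
  qed
  ultimately have "bounded (S -` U)"
    by (rule bounded_subset)
  then have fin: "emeasure lborel (S -` U) = ennreal N"
    unfolding N_def by (intro emeasure_eq_ennreal_measure) (auto simp: less_top[symmetric] dest: emeasure_bounded_finite)
  have "open (S -` U)"
    using \<open>linear S\<close> by (intro open_vimage)
      (auto simp: U_def linear_continuous_on linear_conv_bounded_linear)
  moreover have "0 \<in> S -` U"
    using \<open>linear S\<close> by (simp add: U_def linear_0)
  ultimately obtain e where e: "e > 0" "ball 0 e \<subseteq> S -` U"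
    by (meson openE)
  have "0 < emeasure lborel (ball (0::'a) e)"
    using e(1) by (simp add: emeasure_ball)
  also have "\<dots> \<le> emeasure lborel (S -` U)"
    using e(2) \<open>open (S -` U)\<close> by (intro emeasure_mono) auto
  finally have "N > 0"
    by (simp add: fin)
  have "emeasure lborel (S -` Q) = ennreal (N / V) * emeasure lborel Q" if "Q \<in> sets borel" for Q
  proof -
    have eq: "{x. - S x \<in> U} = S -` U"
      by (auto simp: U_def)
    have "ennreal V * emeasure lborel (S -` Q) = ennreal N * emeasure lborel Q"
      using emeasure_lborel_linear_vimage_symmetric[OF \<open>linear S\<close> bij_is_surj[OF \<open>bij S\<close>] _ that, of U]
      by (simp add: V fin eq mult.commute) (simp add: U_def)
    moreover have "emeasure lborel (S -` Q) = ennreal (1 / V) * (ennreal V * emeasure lborel (S -` Q))"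
      using V(2) by (simp add: mult.assoc[symmetric] ennreal_mult[symmetric])
    ultimately show ?thesis
      using V(2) \<open>N > 0\<close> by (simp add: mult.assoc[symmetric] ennreal_mult[symmetric])
  qed
  moreover have "N / V > 0"
    using \<open>N > 0\<close> V(2) by simp
  ultimately show ?thesis
    using that by blast
qed

section \<open>Block products\<close>

lemma block_dot_linear_right: "linear (block_dot v)"
  by (rule linearI) (simp_all add: block_dot_def scaleR_add_right sum.distrib scaleR_sum_right mult.commute)

lemma block_dot_sum_left:
  "block_dot (\<Sum>i\<in>B. c i *\<^sub>R g i) x = (\<Sum>i\<in>B. c i *\<^sub>R block_dot (g i) x)"
  by (simp add: block_dot_def scaleR_sum_right scaleR_sum_left sum.swap[of _ B])

lemma block_dot_component:
  "block_dot v x $ c = v \<bullet> (\<chi> i. x $ i $ c)"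
  by (simp add: block_dot_def inner_vec_def)

lemma block_dot_measurable[measurable]: "block_dot v \<in> borel_measurable borel"
  by (intro borel_measurable_continuous_onI linear_continuous_on
      linear_conv_bounded_linear[THEN iffD1] block_dot_linear_right)

section \<open>Bases of least weight\<close>

lemma family_basis_card:
  fixes f :: "'m::finite \<Rightarrow> real ^ 'k::finite"
  assumes "family_basis f B"
  shows "card B = CARD('k)"
proof -
  have "card B = card (f ` B)"
    using assms by (simp add: family_basis_def card_image)
  also have "\<dots> = dim (UNIV :: (real ^ 'k) set)"
    using assms by (intro basis_card_eq_dim) (auto simp: family_basis_def)
  finally show ?thesis by simp
qed

lemma family_basis_exchange:
  fixes f :: "'m::finite \<Rightarrow> real ^ 'k::finite"
  assumes B: "family_basis f B" and "i \<in> B" "j \<notin> B" "c i \<noteq> 0"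
    and fj: "f j = (\<Sum>i\<in>B. c i *\<^sub>R f i)"
  shows "family_basis f (insert j (B - {i}))" (is "family_basis f ?B")
proof -
  have "f i = (1 / c i) *\<^sub>R (f j - (\<Sum>i\<in>B - {i}. c i *\<^sub>R f i))"
    using \<open>c i \<noteq> 0\<close> \<open>i \<in> B\<close> by (simp add: fj sum.remove[of B i])
  moreover have "\<dots> \<in> span (f ` ?B)"
    by (intro span_mul span_diff span_sum span_base) auto
  ultimately have fi: "f i \<in> span (f ` ?B)"
    by simp
  have "f ` B \<subseteq> span (f ` ?B)"
  proof
    fix v assume "v \<in> f ` B"
    then show "v \<in> span (f ` ?B)"
      using fi span_base[of v "f ` ?B"] by (cases "v = f i") auto
  qed
  then have "span (f ` B) \<subseteq> span (f ` ?B)"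
    by (simp add: span_minimal)
  then have sp: "span (f ` ?B) = UNIV"
    using B by (auto simp: family_basis_def)
  have cB: "card ?B = CARD('k)"
    using \<open>i \<in> B\<close> \<open>j \<notin> B\<close> family_basis_card[OF B] by (simp add: card.insert_remove card_gt_0_iff)
  moreover have "CARD('k) \<le> card (f ` ?B)"
    using dim_le_card[of "UNIV :: (real ^ 'k) set" "f ` ?B"] sp by simp
  moreover have "card (f ` ?B) \<le> card ?B"
    by (rule card_image_le) simp
  ultimately have card: "card (f ` ?B) = card ?B" by simp
  have "independent (f ` ?B)"
    using sp card cB by (intro card_le_dim_spanning[of _ UNIV]) auto
  moreover have "inj_on f ?B"
    using card by (intro eq_card_imp_inj_on) auto
  ultimately show ?thesis
    using sp by (simp add: family_basis_def)
qed

text \<open>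
  If \<open>f i\<close> occurs in the expansion of \<open>f j\<close>, then exchanging \<open>i\<close> for \<open>j\<close> gives another basis, whose
  weight differs by \<open>w j - w i\<close>.
\<close>
lemma min_weight_basis_expansion:
  fixes f :: "'m::finite \<Rightarrow> real ^ 'k::finite" and w :: "'m \<Rightarrow> real"
  assumes B: "family_basis f B"
    and min: "\<And>B'. family_basis f B' \<Longrightarrow> sum w B \<le> sum w B'"
  obtains c where "f j = (\<Sum>i\<in>B. c i *\<^sub>R f i)" "\<And>i. i \<in> B \<Longrightarrow> c i \<noteq> 0 \<Longrightarrow> w i \<le> w j"
proof (cases "j \<in> B")
  case True
  show ?thesis
    by (rule that[of "\<lambda>i. if i = j then 1 else 0"])
      (use True in \<open>auto simp: if_distrib[of "\<lambda>x. x *\<^sub>R _"] sum.delta' split: if_splits cong: if_cong\<close>)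
next
  case False
  have "f j \<in> span (f ` B)" and inj: "inj_on f B"
    using B by (simp_all add: family_basis_def)
  then obtain u where "f j = (\<Sum>v\<in>f ` B. u v *\<^sub>R v)"
    by (auto simp: span_finite)
  then have fj: "f j = (\<Sum>i\<in>B. u (f i) *\<^sub>R f i)"
    using inj by (simp add: sum.reindex)
  have "w i \<le> w j" if "i \<in> B" "u (f i) \<noteq> 0" for i
  proof -
    have "sum w B \<le> sum w (insert j (B - {i}))"
      by (intro min family_basis_exchange[OF B _ False, where c = "\<lambda>i. u (f i)"] fj that)
    also have "\<dots> = w j + (sum w B - w i)"
      using False that by (simp add: sum_diff1)
    finally show ?thesis by simp
  qed
  then show ?thesis
    using that[of "\<lambda>i. u (f i)"] fj by blast
qed

section \<open>Cubes\<close>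

definition cube :: "real \<Rightarrow> (real ^ 'l::finite) set" where
  "cube r = cbox (\<chi> i. - r) (\<chi> i. r)"

lemma mem_cube: "y \<in> cube r \<longleftrightarrow> (\<forall>i. \<bar>y $ i\<bar> \<le> r)"
  by (auto simp: cube_def mem_box_cart abs_le_iff minus_le_iff)

lemma cube_borel[measurable]: "cube r \<in> sets borel"
  by (simp add: cube_def)

lemma measure_cube:
  assumes "r \<ge> 0"
  shows "measure lborel (cube r :: (real ^ 'l::finite) set) = (2 * r) ^ CARD('l)"
  using assms by (simp add: cube_def content_cbox_if_cart interval_eq_empty_cart not_less)

lemma emeasure_cube:
  assumes "r \<ge> 0"
  shows "emeasure lborel (cube r :: (real ^ 'l::finite) set) = ennreal ((2 * r) ^ CARD('l))"
  unfolding measure_cube[OF assms, symmetric]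
  unfolding cube_def using emeasure_lborel_cbox_finite
  by (intro emeasure_eq_ennreal_measure less_imp_neq) simp

lemma prod_Basis_vec:
  "prod g (Basis :: ('a::euclidean_space ^ 'n::finite) set) = (\<Prod>i\<in>UNIV. \<Prod>u\<in>Basis. g (axis i u))"
proof -
  have "(Basis :: ('a ^ 'n) set) = (\<Union>i\<in>UNIV. axis i ` Basis)"
    by (auto simp: Basis_vec_def)
  also have "prod g \<dots> = (\<Prod>i\<in>UNIV. prod g (axis i ` Basis))"
    by (rule prod.UNION_disjoint) (auto simp: axis_eq_axis nonzero_Basis)
  also have "\<dots> = (\<Prod>i\<in>UNIV. \<Prod>u\<in>Basis. g (axis i u))"
    by (simp add: prod.reindex inj_on_def axis_eq_axis)
  finally show ?thesis .
qed

lemma block_cube_eq_cbox: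
  "{y :: (real ^ 'l::finite) ^ 'k::finite. \<forall>k. y $ k \<in> cube (\<rho> k)} =
     cbox (\<chi> k i. - \<rho> k) (\<chi> k i. \<rho> k)"
proof -
  have "(\<forall>b\<in>(Basis :: ((real ^ 'l) ^ 'k) set). P b) \<longleftrightarrow> (\<forall>k i. P (axis k (axis i 1)))" for P
    by (auto simp: Basis_vec_def)
  then show ?thesis
    by (auto simp: mem_box mem_cube inner_axis abs_le_iff minus_le_iff)
qed

lemma emeasure_block_cube:
  assumes "\<And>k. \<rho> k \<ge> 0"
  shows "emeasure lborel {y :: (real ^ 'l::finite) ^ 'k::finite. \<forall>k. y $ k \<in> cube (\<rho> k)} =
    ennreal (\<Prod>k\<in>UNIV. (2 * \<rho> k) ^ CARD('l))"
proof -
  have "(\<Prod>b\<in>Basis. ((\<chi> k i. \<rho> k) - (\<chi> k i. - \<rho> k) :: (real ^ 'l) ^ 'k) \<bullet> b) =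
      (\<Prod>k\<in>UNIV. \<Prod>u\<in>(Basis :: (real ^ 'l) set). 2 * \<rho> k)"
    unfolding prod_Basis_vec
    by (intro prod.cong refl) (auto simp: inner_axis Basis_vec_def)
  moreover have "(\<chi> k i. - \<rho> k) \<bullet> b \<le> (\<chi> k i. \<rho> k) \<bullet> b" if "b \<in> Basis" for b :: "(real ^ 'l) ^ 'k"
    using that assms by (auto simp: Basis_vec_def inner_axis minus_le_iff intro: order_trans[of _ 0])
  ultimately show ?thesis
    unfolding block_cube_eq_cbox by (simp add: power_mult_distrib)
qed

section \<open>The volume of an intersection of slabs\<close>

text \<open>
  The support of the integrand of \<open>\<Lambda>\<close> when \<open>a\<^sub>j\<close> is the indicator of \<open>cube (r j)\<close>.
\<close>
definition slab_body :: "('m::finite \<Rightarrow> real ^ 'k) \<Rightarrow> ('m \<Rightarrow> real) \<Rightarrow> ((real ^ 'l::finite) ^ 'k) set" where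
  "slab_body f r = {x. \<forall>j. block_dot (f j) x \<in> cube (r j)}"

lemma slab_body_borel[measurable]: "slab_body f r \<in> sets borel"
  for f :: "'m::finite \<Rightarrow> real ^ 'k::finite"
  unfolding slab_body_def by measurable

text \<open>
  The map sending \<open>x\<close> to its block products with the basis vectors is a linear bijection, and
  the set in question is the preimage of a box. It is injective because its kernel, read one
  coordinate of \<open>\<real>\<^sup>l\<close> at a time, consists of vectors orthogonal to a spanning set.
\<close>
lemma basis_body_volume:
  fixes f :: "'m::finite \<Rightarrow> real ^ 'k::finite"
  assumes B: "family_basis f B"
  obtains c where "c > 0" "\<And>r. (\<And>i. 0 \<le> r i) \<Longrightarrow>
    emeasure lborel {x :: (real ^ 'l::finite) ^ 'k. \<forall>i\<in>B. block_dot (f i) x \<in> cube (r i)} =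
      ennreal (c * (\<Prod>i\<in>B. (2 * r i) ^ CARD('l)))"
proof -
  obtain h :: "'k \<Rightarrow> 'm" where h: "bij_betw h UNIV B"
    using family_basis_card[OF B] by (metis finite finite_same_card_bij)
  define S :: "(real ^ 'l) ^ 'k \<Rightarrow> (real ^ 'l) ^ 'k" where "S = (\<lambda>x. \<chi> k. block_dot (f (h k)) x)"
  have "linear S"
    by (rule linearI) (simp_all add: S_def vec_eq_iff linear_add linear_scale block_dot_linear_right)
  have "x = 0" if "S x = 0" for x
  proof -
    have "x $ k $ i = 0" for k i
    proof -
      define z where "z = (\<chi> k. x $ k $ i)"
      have "f (h k) \<bullet> z = 0" for k
        using that unfolding S_def z_def block_dot_component[symmetric] by (simp add: vec_eq_iff)
      then have "orthogonal z v" if "v \<in> f ` B" for v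
        using that h by (auto simp: orthogonal_def inner_commute bij_betw_def)
      then have "orthogonal z z"
        using B orthogonal_to_span[of z "f ` B" z] by (auto simp: family_basis_def)
      then have "z = 0"
        by (simp add: orthogonal_self)
      then show ?thesis
        by (auto simp: z_def vec_eq_iff)
    qed
    then show ?thesis by (simp add: vec_eq_iff)
  qed
  then have "inj S"
    using \<open>linear S\<close> by (simp add: linear_injective_0)
  then have "bij S"
    using \<open>linear S\<close> by (simp add: bij_def linear_injective_imp_surjective)
  then obtain c where c: "c > 0"
    "\<And>Q. Q \<in> sets borel \<Longrightarrow> emeasure lborel (S -` Q) = ennreal c * emeasure lborel Q"
    using emeasure_lborel_linear_vimage[OF \<open>linear S\<close>] by blast
  have "emeasure lborel {x :: (real ^ 'l) ^ 'k. \<forall>i\<in>B. block_dot (f i) x \<in> cube (r i)} =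
      ennreal (c * (\<Prod>i\<in>B. (2 * r i) ^ CARD('l)))" if r: "\<And>i. 0 \<le> r i" for r
  proof -
    let ?Q = "{y :: (real ^ 'l) ^ 'k. \<forall>k. y $ k \<in> cube (r (h k))}"
    have "{x :: (real ^ 'l) ^ 'k. \<forall>i\<in>B. block_dot (f i) x \<in> cube (r i)} = S -` ?Q"
      using h by (auto simp: S_def bij_betw_def)
    also have "emeasure lborel (S -` ?Q) = ennreal c * emeasure lborel ?Q"
      unfolding block_cube_eq_cbox by (rule c(2)) simp
    also have "emeasure lborel ?Q = ennreal (\<Prod>k\<in>UNIV. (2 * r (h k)) ^ CARD('l))"
      using r by (rule emeasure_block_cube)
    also have "(\<Prod>k\<in>UNIV. (2 * r (h k)) ^ CARD('l)) = (\<Prod>i\<in>B. (2 * r i) ^ CARD('l))"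
      by (rule prod.reindex_bij_betw[OF h])
    finally show ?thesis
      using c(1) r by (simp add: ennreal_mult prod_nonneg)
  qed
  then show ?thesis
    using that c(1) by blast
qed

text \<open>
  Shrinking the basis constraints by a factor \<open>A\<close> that dominates all expansion coefficients makes
  them imply the constraints for every other vector, because these vectors use only basis vectors of
  no larger weight, and so, as \<open>t \<ge> 0\<close>, only cubes of no larger half-width.
\<close>
lemma slab_body_volume_lower_bound:
  fixes f :: "'m::finite \<Rightarrow> real ^ 'k::finite" and w :: "'m \<Rightarrow> real"
  assumes B: "family_basis f B"
    and min: "\<And>B'. family_basis f B' \<Longrightarrow> sum w B \<le> sum w B'"
  obtains c where "c > 0" "\<And>t. t \<ge> 0 \<Longrightarrow> ennreal (c * exp (real CARD('l) * t * sum w B))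
    \<le> emeasure lborel (slab_body f (\<lambda>j. exp (t * w j)) :: ((real ^ 'l::finite) ^ 'k) set)"
proof -
  have "\<exists>c. f j = (\<Sum>i\<in>B. c i *\<^sub>R f i) \<and> (\<forall>i\<in>B. c i \<noteq> 0 \<longrightarrow> w i \<le> w j)" for j
    by (rule min_weight_basis_expansion[OF B min, of j]) auto
  then obtain a where fj: "\<And>j. f j = (\<Sum>i\<in>B. a j i *\<^sub>R f i)"
    and aw: "\<And>i j. i \<in> B \<Longrightarrow> a j i \<noteq> 0 \<Longrightarrow> w i \<le> w j"
    by metis
  \<comment> \<open>The summand 1 only ensures \<open>A > 0\<close>.\<close>
  define A where "A = 1 + (\<Sum>j\<in>UNIV. \<Sum>i\<in>B. \<bar>a j i\<bar>)"
  have A: "A > 0"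
    by (auto simp: A_def add_pos_nonneg sum_nonneg)
  have aA: "(\<Sum>i\<in>B. \<bar>a j i\<bar>) \<le> A" for j
    using member_le_sum[of j UNIV "\<lambda>j. \<Sum>i\<in>B. \<bar>a j i\<bar>"] by (simp add: A_def sum_nonneg)
  obtain c where c: "c > 0" "\<And>r. (\<And>i. 0 \<le> r i) \<Longrightarrow>
    emeasure lborel {x :: (real ^ 'l::finite) ^ 'k. \<forall>i\<in>B. block_dot (f i) x \<in> cube (r i)} =
      ennreal (c * (\<Prod>i\<in>B. (2 * r i) ^ CARD('l)))"
    using basis_body_volume[OF B] by blast
  define d where "d = c * (\<Prod>i\<in>B. (2 / A) ^ CARD('l))"
  have "d > 0"
    using A c(1) by (simp add: d_def prod_pos)
  moreover have "ennreal (d * exp (real CARD('l) * t * sum w B))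
    \<le> emeasure lborel (slab_body f (\<lambda>j. exp (t * w j)) :: ((real ^ 'l) ^ 'k) set)" if "t \<ge> 0" for t
  proof -
    define r where "r = (\<lambda>i. exp (t * w i) / A)"
    have r: "0 \<le> r i" for i
      using A by (simp add: r_def)
    have "exp (real CARD('l) * t * sum w B) = (\<Prod>i\<in>B. exp (t * w i) ^ CARD('l))"
      by (simp add: sum_distrib_left exp_sum exp_of_nat_mult[symmetric] mult.assoc)
    then have "d * exp (real CARD('l) * t * sum w B) = c * (\<Prod>i\<in>B. (2 * r i) ^ CARD('l))"
      by (simp add: d_def r_def mult.assoc prod.distrib[symmetric] power_mult_distrib[symmetric]
          del: prod_constant)
    then have "ennreal (d * exp (real CARD('l) * t * sum w B)) =
        emeasure lborel {x :: (real ^ 'l) ^ 'k. \<forall>i\<in>B. block_dot (f i) x \<in> cube (r i)}"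
      using c(2)[OF r] by simp
    also have "\<dots> \<le> emeasure lborel (slab_body f (\<lambda>j. exp (t * w j)) :: ((real ^ 'l) ^ 'k) set)"
    proof (rule emeasure_mono)
      show "{x :: (real ^ 'l) ^ 'k. \<forall>i\<in>B. block_dot (f i) x \<in> cube (r i)}
        \<subseteq> slab_body f (\<lambda>j. exp (t * w j))"
      proof (clarsimp simp: slab_body_def mem_cube)
        fix x :: "(real ^ 'l) ^ 'k" and j l
        assume x: "\<forall>i\<in>B. \<forall>l. \<bar>block_dot (f i) x $ l\<bar> \<le> r i"
        have "\<bar>block_dot (f j) x $ l\<bar> = \<bar>\<Sum>i\<in>B. a j i * (block_dot (f i) x $ l)\<bar>"
          by (subst fj) (simp add: block_dot_sum_left)
        also have "\<dots> \<le> (\<Sum>i\<in>B. \<bar>a j i\<bar> * \<bar>block_dot (f i) x $ l\<bar>)"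
          by (rule order_trans[OF sum_abs]) (simp add: abs_mult)
        also have "\<dots> \<le> (\<Sum>i\<in>B. \<bar>a j i\<bar> * r j)"
        proof (rule sum_mono)
          fix i assume i: "i \<in> B"
          show "\<bar>a j i\<bar> * \<bar>block_dot (f i) x $ l\<bar> \<le> \<bar>a j i\<bar> * r j"
          proof (cases "a j i = 0")
            case False
            have "\<bar>block_dot (f i) x $ l\<bar> \<le> r i"
              using x i by blast
            also have "\<dots> \<le> r j"
              using aw[OF i False] A \<open>t \<ge> 0\<close> by (simp add: r_def divide_right_mono mult_left_mono)
            finally show ?thesis
              by (simp add: mult_left_mono)
          qed simp
        qed
        also have "\<dots> \<le> A * r j"
          unfolding sum_distrib_right[symmetric] by (intro mult_right_mono aA r)
        finally show "\<bar>block_dot (f j) x $ l\<bar> \<le> exp (t * w j)"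
          using A by (simp add: r_def)
      qed
    qed measurable
    finally show ?thesis .
  qed
  ultimately show ?thesis
    using that by blast
qed

text \<open>
  Translates of the ball by multiples of a vector of length \<open>2 * e\<close> parallel to \<open>p\<close> are disjoint, all
  contained in \<open>E\<close>, and all of the same positive volume.
\<close>
lemma emeasure_lborel_translation_invariant_infinite:
  fixes E :: "'a::euclidean_space set"
  assumes "E \<in> sets borel" "ball 0 e \<subseteq> E" "e > 0" "p \<noteq> 0"
    and inv: "\<And>s x. x \<in> E \<Longrightarrow> s *\<^sub>R p + x \<in> E"
  shows "emeasure lborel E = \<infinity>"
proof -
  define q where "q = (2 * e / norm p) *\<^sub>R p"
  define D where "D = (\<lambda>n::nat. ball (real n *\<^sub>R q) e)"
  have nq: "norm q = 2 * e"
    using assms by (simp add: q_def)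
  have "disjoint_family D"
    unfolding disjoint_family_on_def
  proof (intro ballI impI)
    fix m n :: nat assume "m \<noteq> n"
    then have "1 \<le> \<bar>real m - real n\<bar>" by linarith
    then have "2 * e \<le> \<bar>real m - real n\<bar> * norm q"
      using \<open>e > 0\<close> by (simp add: nq)
    also have "\<dots> = dist (real m *\<^sub>R q) (real n *\<^sub>R q)"
      by (simp add: dist_norm scaleR_diff_left[symmetric])
    finally show "D m \<inter> D n = {}"
      unfolding D_def by (intro disjoint_ballI) simp
  qed
  have "D n \<subseteq> E" for n
  proof
    fix x assume "x \<in> D n"
    then have "x - real n *\<^sub>R q \<in> E"
      using assms(2) by (auto simp: D_def dist_norm norm_minus_commute)
    then have "(real n * (2 * e / norm p)) *\<^sub>R p + (x - real n *\<^sub>R q) \<in> E"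
      by (rule inv)
    then show "x \<in> E" by (simp add: q_def)
  qed
  then have "emeasure lborel (\<Union>n. D n) \<le> emeasure lborel E"
    using assms(1) by (intro emeasure_mono) auto
  moreover have "emeasure lborel (\<Union>n. D n) = (\<Sum>n. emeasure lborel (D n))"
    using \<open>disjoint_family D\<close> by (intro suminf_emeasure[symmetric]) (auto simp: D_def)
  moreover have "\<dots> = (\<Sum>n::nat. emeasure lborel (ball (0::'a) e))"
    using \<open>e > 0\<close> by (simp add: D_def emeasure_ball)
  moreover have "\<dots> = \<infinity>"
  proof -
    define v where "v = unit_ball_vol (real DIM('a)) * e ^ DIM('a)"
    have "v > 0"
      using \<open>e > 0\<close> by (simp add: v_def)
    then have "\<not> summable (\<lambda>n::nat. v)"
      by (auto simp only: summable_const_iff)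
    then have "(\<Sum>n::nat. ennreal v) = \<infinity>"
      using \<open>v > 0\<close> unfolding infinity_ennreal_def
      by (intro summable_iff_suminf_neq_top) (rule less_imp_le)
    moreover have "emeasure lborel (ball (0::'a) e) = ennreal v"
      using \<open>e > 0\<close> by (simp add: emeasure_ball v_def)
    ultimately show ?thesis
      by (simp only:)
  qed
  ultimately show ?thesis
    by (simp add: top_unique)
qed

lemma family_basis_exists:
  fixes f :: "'m::finite \<Rightarrow> real ^ 'k::finite"
  assumes "span (range f) = UNIV"
  obtains B where "family_basis f B"
proof -
  obtain V where V: "V \<subseteq> range f" "independent V" "range f \<subseteq> span V"
    using maximal_independent_subset by blast
  then obtain B where B: "inj_on f B" "f ` B = V"
    by (metis subset_image_inj)
  have "span V = UNIV"
    using assms V(3) span_minimal[OF V(3) subspace_span] by auto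
  then show ?thesis
    using that B V(2) by (auto simp: family_basis_def)
qed

text \<open>
  Without a basis, some \<open>v \<noteq> 0\<close> is orthogonal to every \<open>f j\<close>. The block vector all of whose
  \<open>\<real>\<^sup>l\<close>-coordinates are copies of \<open>v\<close> has vanishing block products, so translating along it stays
  inside the set.
\<close>
lemma slab_body_infinite_volume:
  fixes f :: "'m::finite \<Rightarrow> real ^ 'k::finite"
  assumes "\<nexists>B. family_basis f B"
  shows "emeasure lborel (slab_body f (\<lambda>_. 1) :: ((real ^ 'l::finite) ^ 'k) set) = \<infinity>"
proof -
  let ?E = "slab_body f (\<lambda>_. 1) :: ((real ^ 'l) ^ 'k) set"
  have "span (range f) \<noteq> UNIV"
    using assms family_basis_exists by blast
  then have "dim (range f) < DIM(real ^ 'k)"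
    by (metis dim_eq_full dim_subset_UNIV le_neq_implies_less)
  then obtain v where v: "v \<noteq> 0" "\<And>y. y \<in> span (range f) \<Longrightarrow> orthogonal v y"
    using orthogonal_to_subspace_exists by blast
  define p :: "(real ^ 'l) ^ 'k" where "p = (\<chi> k l. v $ k)"
  have "p \<noteq> 0"
    using v(1) by (auto simp: p_def vec_eq_iff)
  have p: "block_dot (f j) p = 0" for j
    using v(2)[of "f j"] unfolding vec_eq_iff block_dot_component
    by (simp add: p_def span_base orthogonal_def inner_commute)
  \<comment> \<open>An open neighbourhood of the origin inside the set, obtained by shrinking cubes to open boxes.\<close>
  define O' where "O' = (\<Inter>j. block_dot (f j) -` (box (\<chi> i. - 1) (\<chi> i. 1) :: (real ^ 'l) set))"
  have "open O'"
    unfolding O'_def by (intro open_INT finite ballI open_vimage open_box)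
      (intro linear_continuous_on linear_conv_bounded_linear[THEN iffD1] block_dot_linear_right)
  moreover have "0 \<in> O'"
    by (auto simp: O'_def linear_0[OF block_dot_linear_right] mem_box_cart)
  ultimately obtain e where e: "e > 0" "ball 0 e \<subseteq> O'"
    by (meson openE)
  have "O' \<subseteq> ?E"
    using box_subset_cbox by (fastforce simp: O'_def slab_body_def cube_def)
  have "s *\<^sub>R p + x \<in> ?E" if "x \<in> ?E" for s x
    using that by (simp add: slab_body_def linear_add[OF block_dot_linear_right]
        linear_scale[OF block_dot_linear_right] p)
  then show ?thesis
    using e \<open>O' \<subseteq> ?E\<close> \<open>p \<noteq> 0\<close>
    by (intro emeasure_lborel_translation_invariant_infinite[of _ e p]) auto
qed

section \<open>Testing the estimate on indicators of cubes\<close>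

lemma esssup_indicator:
  assumes "A \<in> sets M" "emeasure M A \<noteq> 0"
  shows "esssup M (\<lambda>x. ereal (indicator A x)) = 1"
proof (rule antisym)
  show "esssup M (\<lambda>x. ereal (indicator A x)) \<le> 1"
    using assms(1) by (intro esssup_I) (auto simp: indicator_def)
  show "1 \<le> esssup M (\<lambda>x. ereal (indicator A x))"
  proof (rule ccontr)
    assume "\<not> ?thesis"
    then have "AE x in M. x \<notin> A"
      using esssup_AE[of "\<lambda>x. ereal (indicator A x)" M]
      by (auto elim!: eventually_mono simp: not_le one_ereal_def)
    then show False
      using assms by (simp add: AE_iff_null_sets[symmetric] null_sets_def)
  qed
qed

lemma Lnorm_indicator:
  assumes A: "A \<in> sets borel" "measure lborel A > 0"
  shows "Lnorm t (indicator A) = measure lborel A powr t"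
proof (cases "t = 0")
  case True
  have "emeasure lborel A \<noteq> 0"
    using A(2) by (auto simp: measure_def)
  then show ?thesis
    using True A by (simp add: Lnorm_def esssup_indicator)
next
  case False
  have "(\<lambda>x. indicator A x powr (1 / t)) = indicator A"
    by (auto simp: indicator_def)
  then show ?thesis
    using False by (simp add: Lnorm_def)
qed

lemma indicator_cube_L1_Linf:
  assumes "r > 0"
  shows "indicator (cube r) \<in> L1_Linf"
proof -
  have "emeasure lborel (cube r) \<noteq> 0"
    using assms by (simp add: emeasure_cube)
  then show ?thesis
    using assms by (simp add: L1_Linf_def esssup_indicator integrable_indicator_iff emeasure_cube)
qed

lemma Lambda_integrand_cubes:
  "Lambda_integrand f (\<lambda>j. indicator (cube (r j))) = indicator (slab_body f r)"
proof
  fix x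
  show "Lambda_integrand f (\<lambda>j. indicator (cube (r j))) x = indicator (slab_body f r) x"
    by (cases "x \<in> slab_body f r") (auto simp: Lambda_integrand_def slab_body_def indicator_def)
qed

lemma slab_body_volume_upper_bound:
  fixes f :: "'m::finite \<Rightarrow> real ^ 'k::finite"
  assumes C: "\<And>a :: 'm \<Rightarrow> real ^ 'l::finite \<Rightarrow> real. (\<And>j. a j \<in> L1_Linf) \<Longrightarrow>
      integrable lborel (Lambda_integrand f a) \<and>
      \<bar>Lambda f a\<bar> \<le> C * (\<Prod>j\<in>UNIV. Lnorm (\<theta> j) (a j))"
    and r: "\<And>j. r j > 0"
  shows "emeasure lborel (slab_body f r :: ((real ^ 'l) ^ 'k) set) < \<infinity>"
    and "measure lborel (slab_body f r :: ((real ^ 'l) ^ 'k) set)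
      \<le> C * (\<Prod>j\<in>UNIV. ((2 * r j) ^ CARD('l)) powr \<theta> j)"
proof -
  let ?E = "slab_body f r :: ((real ^ 'l) ^ 'k) set"
  let ?a = "\<lambda>j. indicator (cube (r j)) :: real ^ 'l \<Rightarrow> real"
  have int: "integrable lborel (Lambda_integrand f ?a)"
    and bound: "\<bar>Lambda f ?a\<bar> \<le> C * (\<Prod>j\<in>UNIV. Lnorm (\<theta> j) (?a j))"
    using C[of ?a] by (simp_all add: indicator_cube_L1_Linf r)
  show "emeasure lborel ?E < \<infinity>"
    using int by (simp add: Lambda_integrand_cubes integrable_indicator_iff)
  have "Lnorm (\<theta> j) (?a j) = ((2 * r j) ^ CARD('l)) powr \<theta> j" for j
    using r[of j] by (simp add: Lnorm_indicator measure_cube)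
  moreover have "Lambda f ?a = measure lborel ?E"
    by (simp add: Lambda_def Lambda_integrand_cubes)
  ultimately show "measure lborel ?E \<le> C * (\<Prod>j\<in>UNIV. ((2 * r j) ^ CARD('l)) powr \<theta> j)"
    using bound by simp
qed

lemma exp_growth_rate_le:
  fixes u v :: real
  assumes "c > 0" and le: "\<And>t. t \<ge> 0 \<Longrightarrow> c * exp (t * u) \<le> K * exp (t * v)"
  shows "u \<le> v"
proof (rule ccontr)
  assume "\<not> u \<le> v"
  \<comment> \<open>With this \<open>t\<close>, the linear bound \<open>1 + x \<le> exp x\<close> already gives \<open>c + \<bar>K\<bar> \<le> K\<close>.\<close>
  define t where "t = \<bar>K\<bar> / (c * (u - v))"
  have t: "t \<ge> 0" "t * (u - v) = \<bar>K\<bar> / c"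
    using \<open>\<not> u \<le> v\<close> \<open>c > 0\<close> by (simp_all add: t_def)
  have "c * exp (t * (u - v)) \<le> K"
    using le[OF t(1)] by (simp add: right_diff_distrib exp_diff field_simps)
  moreover have "c * (1 + t * (u - v)) \<le> c * exp (t * (u - v))"
    using \<open>c > 0\<close> by (simp add: exp_ge_add_one_self)
  ultimately show False
    using \<open>c > 0\<close> by (simp add: t(2) distrib_left)
qed

theorem corollary2p4:
  fixes f :: "'m::finite \<Rightarrow> real ^ 'k::finite" and \<theta> :: "real ^ 'm"
  assumes "\<And>j. 0 \<le> \<theta> $ j \<and> \<theta> $ j \<le> 1"
    and "\<exists>C::real. \<forall>a :: 'm \<Rightarrow> real ^ 'l::finite \<Rightarrow> real. (\<forall>j. a j \<in> L1_Linf) \<longrightarrow>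
           integrable lborel (Lambda_integrand f a) \<and>
           \<bar>Lambda f a\<bar> \<le> C * (\<Prod>j\<in>UNIV. Lnorm (\<theta> $ j) (a j))"
  shows "\<theta> \<in> matroid_polytope f"
proof (rule ccontr)
  assume "\<theta> \<notin> matroid_polytope f"
  obtain C where C: "\<And>a :: 'm \<Rightarrow> real ^ 'l \<Rightarrow> real. (\<And>j. a j \<in> L1_Linf) \<Longrightarrow>
      integrable lborel (Lambda_integrand f a) \<and>
      \<bar>Lambda f a\<bar> \<le> C * (\<Prod>j\<in>UNIV. Lnorm (\<theta> $ j) (a j))"
    using assms(2) by blast
  have fin: "emeasure lborel (slab_body f r :: ((real ^ 'l) ^ 'k) set) < \<infinity>" if "\<And>j. r j > 0" for r
    by (rule slab_body_volume_upper_bound(1)[OF C that])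
  let ?bases = "{B. family_basis f B}"
  have "\<exists>B. family_basis f B"
  proof (rule ccontr)
    assume "\<nexists>B. family_basis f B"
    then have "emeasure lborel (slab_body f (\<lambda>_. 1) :: ((real ^ 'l) ^ 'k) set) = \<infinity>"
      by (rule slab_body_infinite_volume)
    then show False
      using fin[of "\<lambda>_. 1"] by simp
  qed
  then have "?bases \<noteq> {}"
    by blast
  have "finite {chi_vec B | B. family_basis f B}"
    by simp
  then have "closed (matroid_polytope f)"
    unfolding matroid_polytope_def by (intro compact_imp_closed finite_imp_compact_convex_hull)
  then obtain a b where ab: "a \<bullet> \<theta> < b" "\<And>x. x \<in> matroid_polytope f \<Longrightarrow> b < a \<bullet> x"
    using separating_hyperplane_closed_point[of "matroid_polytope f" \<theta>] \<open>\<theta> \<notin> matroid_polytope f\<close>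
    by (auto simp: matroid_polytope_def)
  define w where "w = (\<lambda>j. a $ j)"
  define B where "B = arg_min_on (sum w) ?bases"
  have B: "family_basis f B" and min: "\<And>B'. family_basis f B' \<Longrightarrow> sum w B \<le> sum w B'"
    using arg_min_if_finite(1)[of ?bases "sum w"] arg_min_least[of ?bases _ "sum w"] \<open>?bases \<noteq> {}\<close>
    by (auto simp: B_def)
  have "chi_vec B \<in> matroid_polytope f"
    unfolding matroid_polytope_def using B by (intro hull_inc) blast
  moreover have "a \<bullet> chi_vec B = sum w B"
    by (simp add: inner_vec_def chi_vec_def w_def if_distrib[of "\<lambda>x. _ * x"] sum.If_cases cong: if_cong)
  ultimately have gap: "a \<bullet> \<theta> < sum w B"
    using ab by force
  obtain c where c: "c > 0" "\<And>t. t \<ge> 0 \<Longrightarrow> ennreal (c * exp (real CARD('l) * t * sum w B))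
    \<le> emeasure lborel (slab_body f (\<lambda>j. exp (t * w j)) :: ((real ^ 'l) ^ 'k) set)"
    using slab_body_volume_lower_bound[OF B min] by blast
  define K where "K = C * (\<Prod>j\<in>UNIV. (2 ^ CARD('l)) powr (\<theta> $ j))"
  have "c * exp (t * (real CARD('l) * sum w B)) \<le> K * exp (t * (real CARD('l) * (a \<bullet> \<theta>)))"
    if "t \<ge> 0" for t
  proof -
    let ?E = "slab_body f (\<lambda>j. exp (t * w j)) :: ((real ^ 'l) ^ 'k) set"
    have "((2 * exp (t * w j)) ^ CARD('l)) powr (\<theta> $ j) =
        (2 ^ CARD('l)) powr (\<theta> $ j) * exp (t * (real CARD('l) * (a $ j * \<theta> $ j)))" for j
      by (simp add: power_mult_distrib powr_mult exp_of_nat_mult[symmetric] exp_powr_real w_def mult_ac)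
    then have "C * (\<Prod>j\<in>UNIV. ((2 * exp (t * w j)) ^ CARD('l)) powr (\<theta> $ j)) =
        K * exp (t * (real CARD('l) * (a \<bullet> \<theta>)))"
      by (simp add: K_def prod.distrib exp_sum[symmetric] sum_distrib_left inner_vec_def)
    moreover have "measure lborel ?E \<le> C * (\<Prod>j\<in>UNIV. ((2 * exp (t * w j)) ^ CARD('l)) powr (\<theta> $ j))"
      by (rule slab_body_volume_upper_bound(2)[OF C]) auto
    moreover have "emeasure lborel ?E = ennreal (measure lborel ?E)"
      using fin[of "\<lambda>j. exp (t * w j)"] by (intro emeasure_eq_ennreal_measure) auto
    ultimately show ?thesis
      using c(2)[OF that] by (simp add: mult_ac)
  qed
  then have "real CARD('l) * sum w B \<le> real CARD('l) * (a \<bullet> \<theta>)"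
    by (rule exp_growth_rate_le[OF c(1)])
  then show False
    using gap by simp
qed

end
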